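(* Let $b>0$ and let $t\mapsto\alpha(t)$, $t\mapsto\theta(t)$ be continuous functions on $[0,\infty)$ with $\alpha(t)\in(0,2]$, $\alpha(t)\ne1$ and $|\theta(t)|\le\min\{\alpha(t),2-\alpha(t)\}$ for all $t\ge0$. Let $G^I_{\alpha,\theta}$ be the first-type inhomogeneous geometric stable process, and let $f\in\mathcal{S}(\mathbb{R})$, $s\ge0$. Then $$u(x,t)=T_{s,t}^{G^I_{\alpha,\theta}}f(x):=\mathbb{E}\big[f(G^I_{\alpha,\theta}(t))\,\big|\,G^I_{\alpha,\theta}(s)=x\big],\qquad t\ge s,$$ satisfies the initial value problem $$\begin{cases}\dfrac{\partial}{\partial t}u(x,t)=\mathcal{P}_{b,x}^{\alpha(t),\theta(t)}u(x,t),& t\ge s,\\[4pt] u(x,s)=f(x).\end{cases}$$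
   Context: For $\alpha\in(0,2]$, $\alpha\neq 1$, $|\theta|\le\min\{\alpha,2-\alpha\}$ put $\psi_{\alpha,\theta}(\xi)=|\xi|^\alpha e^{i\,\mathrm{sign}(\xi)\pi\theta/2}$, $\xi\in\mathbb{R}$. The process $G^I_{\alpha,\theta}=\{G^I_{\alpha,\theta}(t),t\ge0\}$ is the additive process (stochastically continuous, started at $0$, independent increments) defined by the joint characteristic function $$\mathbb{E}e^{i\sum_{j=1}^d\xi_jG^I_{\alpha,\theta}(t_j)}=\exp\Big\{-\int_0^\infty\ln\Big(1+b\,\psi_{\alpha(z),\theta(z)}\Big(\sum_{j=1}^d\xi_j1_{[0,t_j]}(z)\Big)\Big)dz\Big\},\quad \xi_j\in\mathbb{R},\ t_j\ge0,\ d\in\mathbb{N},$$ with the principal branch of $\ln$. The conditional expectation $\mathbb{E}[f(X(t))|X(s)=x]$ for an additive process $X$ is $\mathbb{E}f(x+X(t)-X(s))$. Fourier transform: $\tilde f(\xi)=\frac1{\sqrt{2\pi}}\int_{\mathbb{R}}e^{-i\xi x}f(x)dx$. The operator $\overline{\mathcal{D}^{\alpha(t),\theta(t)}}$ (adjoint of the Riesz–Feller derivative with time-varying parameters) is the Fourier multiplier with symbol $-\psi_{\alpha(t),\theta(t)}(\xi)$, i.e. the Fourier transform of $\overline{\mathcal{D}_x^{\alpha(t),\theta(t)}}f$ is $-\psi_{\alpha(t),\theta(t)}(\xi)\tilde f(\xi)$. The operator $$\mathcal{P}_b^{\alpha(t),\theta(t)}:=-\ln\big(1-b\,\overline{\mathcal{D}^{\alpha(t),\theta(t)}}\big)=\int_{b^{-1}}^\infty\frac1z\,\overline{\mathcal{D}^{\alpha(t),\theta(t)}}\big(z-\overline{\mathcal{D}^{\alpha(t),\theta(t)}}\big)^{-1}dz$$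 has symbol $-\ln(1+b\,\psi_{\alpha(t),\theta(t)}(\xi))$; it acts as a Fourier multiplier on functions (such as $u(\cdot,t)$) which are inverse Fourier transforms of functions decaying faster than any power. The subscript $x$ means the operator acts in the variable $x$. At $t=s$ the time derivative is the right derivative. $\mathcal{S}(\mathbb{R})$ is the Schwartz space. *)

theory Defs
  imports "HOL-Probability.Probability" "HOL-Real_Asymp.Real_Asymp"
begin

definition psi :: "real \<Rightarrow> real \<Rightarrow> real \<Rightarrow> complex" where
  "psi \<alpha> \<theta> \<xi> = complex_of_real (\<bar>\<xi>\<bar> powr \<alpha>) * iexp (sgn \<xi> * pi * \<theta> / 2)"


subsection \<open>Processes\<close>

definition independent_increments :: "'a measure \<Rightarrow> (real \<Rightarrow> 'a \<Rightarrow> real) \<Rightarrow> bool" where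
  "independent_increments M X \<longleftrightarrow>
     (\<forall>(n::nat) (t::nat \<Rightarrow> real). 0 \<le> t 0 \<and> mono_on {..n} t \<longrightarrow>
        prob_space.indep_vars M (\<lambda>_. borel) (\<lambda>i \<omega>. X (t (Suc i)) \<omega> - X (t i) \<omega>) {..<n})"

definition stochastically_continuous :: "'a measure \<Rightarrow> (real \<Rightarrow> 'a \<Rightarrow> real) \<Rightarrow> bool" where
  "stochastically_continuous M X \<longleftrightarrow>
     (\<forall>t\<ge>0. \<forall>\<epsilon>>0.
        ((\<lambda>r. measure M {\<omega> \<in> space M. \<bar>X r \<omega> - X t \<omega>\<bar> \<ge> \<epsilon>}) \<longlongrightarrow> 0) (at t within {0..}))"

text \<open>Only the variables \<open>X t\<close> with \<open>t \<ge> 0\<close> belong to the process.\<close>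

definition additive_process :: "'a measure \<Rightarrow> (real \<Rightarrow> 'a \<Rightarrow> real) \<Rightarrow> bool" where
  "additive_process M X \<longleftrightarrow>
     prob_space M \<and>
     (\<forall>t\<ge>0. X t \<in> borel_measurable M) \<and>
     (AE \<omega> in M. X 0 \<omega> = 0) \<and>
     independent_increments M X \<and>
     stochastically_continuous M X"

text \<open>The inhomogeneous geometric stable process of the first type.\<close>

definition geometric_stable_process_I ::
  "'a measure \<Rightarrow> real \<Rightarrow> (real \<Rightarrow> real) \<Rightarrow> (real \<Rightarrow> real) \<Rightarrow> (real \<Rightarrow> 'a \<Rightarrow> real) \<Rightarrow> bool" where
  "geometric_stable_process_I M b \<alpha> \<theta> G \<longleftrightarrow>
     additive_process M G \<and>
     (\<forall>(d::nat) (\<xi>::nat \<Rightarrow> real) (t::nat \<Rightarrow> real). (\<forall>j<d. 0 \<le> t j) \<longrightarrow>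
        (CLINT \<omega>|M. iexp (\<Sum>j<d. \<xi> j * G (t j) \<omega>)) =
        exp (- (CLBINT z:{0..}.
          Ln (1 + complex_of_real b * psi (\<alpha> z) (\<theta> z) (\<Sum>j<d. \<xi> j * indicator {0..t j} z)))))"

text \<open>
  For an additive process, the conditional expectation of \<open>f (X t)\<close> given \<open>X s = x\<close> is by
  convention this expectation, so that it is defined for every \<open>x\<close>.
\<close>

definition transition_op ::
  "'a measure \<Rightarrow> (real \<Rightarrow> 'a \<Rightarrow> real) \<Rightarrow> real \<Rightarrow> real \<Rightarrow> (real \<Rightarrow> complex) \<Rightarrow> real \<Rightarrow> complex" where
  "transition_op M X s t f x = (CLINT \<omega>|M. f (x + X t \<omega> - X s \<omega>))"


subsection \<open>Schwartz functions and Fourier multipliers\<close>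

text \<open>\<open>F n\<close> is the \<open>n\<close>-th derivative of \<open>f\<close>.\<close>

definition schwartz :: "(real \<Rightarrow> complex) \<Rightarrow> bool" where
  "schwartz f \<longleftrightarrow>
     (\<exists>F :: nat \<Rightarrow> real \<Rightarrow> complex. F 0 = f \<and>
        (\<forall>n x. (F n has_vector_derivative F (Suc n) x) (at x)) \<and>
        (\<forall>m n. bounded (range (\<lambda>x. x ^ m *\<^sub>R F n x))))"

definition fourier :: "(real \<Rightarrow> complex) \<Rightarrow> real \<Rightarrow> complex" where
  "fourier f \<xi> = complex_of_real (1 / sqrt (2 * pi)) * (CLBINT x. iexp (- (\<xi> * x)) * f x)"

definition inverse_fourier :: "(real \<Rightarrow> complex) \<Rightarrow> real \<Rightarrow> complex" where
  "inverse_fourier h x = complex_of_real (1 / sqrt (2 * pi)) * (CLBINT \<xi>. iexp (\<xi> * x) * h \<xi>)"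

text \<open>
  Meaningful for integrable \<open>g\<close> with \<open>m \<xi> * fourier g \<xi>\<close> integrable in \<open>\<xi>\<close>; this holds
  if \<open>g\<close> is integrable, \<open>fourier g\<close> decays faster than any power and \<open>m\<close> is measurable and
  of at most polynomial growth.
\<close>

definition fourier_multiplier :: "(real \<Rightarrow> complex) \<Rightarrow> (real \<Rightarrow> complex) \<Rightarrow> real \<Rightarrow> complex" where
  "fourier_multiplier m g = inverse_fourier (\<lambda>\<xi>. m \<xi> * fourier g \<xi>)"

text \<open>
  The adjoint \<open>D\<close> of the Riesz-Feller derivative is the Fourier multiplier with the following
  symbol, and \<open>geometric_op\<close> is \<open>- ln (1 - b D)\<close>.
\<close>

definition riesz_feller_adj_symbol :: "real \<Rightarrow> real \<Rightarrow> real \<Rightarrow> complex" where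
  "riesz_feller_adj_symbol \<alpha> \<theta> \<xi> = - psi \<alpha> \<theta> \<xi>"

definition geometric_op ::
  "real \<Rightarrow> real \<Rightarrow> real \<Rightarrow> (real \<Rightarrow> complex) \<Rightarrow> real \<Rightarrow> complex" where
  "geometric_op b \<alpha> \<theta> =
     fourier_multiplier (\<lambda>\<xi>. - Ln (1 - complex_of_real b * riesz_feller_adj_symbol \<alpha> \<theta> \<xi>))"


subsection \<open>The resolvent formula on the level of symbols\<close>

lemma Re_psi_nonneg:
  assumes "0 < \<alpha>" "\<alpha> \<le> 2" "\<bar>\<theta>\<bar> \<le> min \<alpha> (2 - \<alpha>)"
  shows "Re (psi \<alpha> \<theta> \<xi>) \<ge> 0"
proof -
  have "\<bar>\<theta>\<bar> \<le> 1" using assms by (auto simp: min_def split: if_splits)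
  hence "pi * \<bar>\<theta>\<bar> \<le> pi" by simp
  have "\<bar>sgn \<xi> * pi * \<theta> / 2\<bar> \<le> pi/2"
    using \<open>pi * \<bar>\<theta>\<bar> \<le> pi\<close> by (auto simp: abs_mult sgn_if)
  hence "cos (sgn \<xi> * pi * \<theta> / 2) \<ge> 0" by (intro cos_ge_zero) linarith+
  thus ?thesis by (simp add: psi_def Re_exp)
qed

lemma resolvent_integral_Ln:
  fixes b :: real and m :: complex
  assumes b: "b > 0" and m: "Re m \<le> 0"
  shows "set_integrable lborel {1/b<..} (\<lambda>z. 1 / complex_of_real z * (m / (complex_of_real z - m)))"
    and "(CLBINT z:{1/b<..}. 1 / complex_of_real z * (m / (complex_of_real z - m))) =
           - Ln (1 - complex_of_real b * m)"
proof -
  define p where "p = - m"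
  have p: "Re p \<ge> 0" and mp: "m = - p" using m by (auto simp: p_def)
  let ?f = "\<lambda>z::real. 1 / complex_of_real z * (- p / (complex_of_real z - (- p)))"
  let ?F = "\<lambda>z::real. Ln (1 + p / z)"
  have nz: "z + p \<noteq> 0" if "z > 0" for z :: real
    using that p by (auto simp: complex_eq_iff)
  have nr: "1 + p / z \<notin> \<real>\<^sub>\<le>\<^sub>0" if "z > 0" for z :: real
    using that p by (auto simp: complex_nonpos_Reals_iff Re_divide_of_real) (smt (verit) divide_nonneg_pos)
  have cont: "continuous_on {1/b..} ?f"
  proof -
    have "z > 0" if "z \<in> {1/b..}" for z using that b by (smt (verit) atLeast_iff divide_pos_pos)
    thus ?thesis using nz by (intro continuous_intros) fastforce+
  qed
  have nrm: "norm (?f z) \<le> norm p * (1 / z^2)" if "z \<ge> 1/b" for z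
  proof -
    have z: "z > 0" using that b by (smt (verit) divide_pos_pos)
    have "z \<le> cmod (z + p)" using complex_Re_le_cmod[of "z + p"] p z by simp
    hence "cmod p / (z * cmod (z + p)) \<le> cmod p / (z * z)"
      using z by (intro divide_left_mono mult_left_mono mult_pos_pos) auto
    moreover have "norm (?f z) = cmod p / (z * cmod (z + p))"
      using z by (simp add: norm_mult norm_divide)
    ultimately show ?thesis by (simp add: power2_eq_square)
  qed
  have ein: "einterval (ereal (1/b)) \<infinity> = {1/b<..}" by (auto simp: einterval_def)
  have I0: "set_integrable lborel {1/b<..} (\<lambda>z. 1 / z^2)"
  proof -
    have "set_integrable lborel (einterval (ereal (1/b)) \<infinity>) (\<lambda>z. 1 / z^2)"
    proof (rule interval_integral_FTC_nonneg(1)[where F = "\<lambda>z. - (1 / z)" and A = "-b" and B = 0])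
      fix x assume "ereal (1/b) < ereal x"
      hence x: "x > 0" using b by (smt (verit) divide_pos_pos less_ereal.simps(1))
      show "((\<lambda>z. - (1 / z)) has_real_derivative 1 / x^2) (at x)"
        using x by (auto intro!: derivative_eq_intros simp: power2_eq_square)
      show "isCont (\<lambda>z. 1 / z^2) x" using x by (intro continuous_intros) auto
    next
      have "((\<lambda>z. - (1 / z)) \<longlongrightarrow> - (1 / (1/b))) (at_right (1/b))"
        using b by (intro tendsto_intros) auto
      thus "(((\<lambda>z. - (1 / z)) \<circ> real_of_ereal) \<longlongrightarrow> -b) (at_right (ereal (1/b)))"
        by (simp add: ereal_tendsto_simps)
      have "((\<lambda>z::real. - (1 / z)) \<longlongrightarrow> 0) at_top" by real_asymp
      thus "(((\<lambda>z. - (1 / z)) \<circ> real_of_ereal) \<longlongrightarrow> 0) (at_left \<infinity>)"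
        by (simp add: ereal_tendsto_simps)
    qed auto
    thus ?thesis by (simp add: ein)
  qed
  have I1: "set_integrable lborel {1/b<..} (\<lambda>z. norm p * (1 / z^2))"
    by (rule set_integrable_mult_right) (rule I0)
  have I: "set_integrable lborel {1/b<..} ?f"
  proof (rule set_integrable_bound[OF I1])
    have "continuous_on {1/b<..} ?f" by (rule continuous_on_subset[OF cont]) auto
    thus "set_borel_measurable lborel {1/b<..} ?f"
      using borel_measurable_continuous_on_indicator[of "{1/b<..}" ?f] by (simp add: set_borel_measurable_def)
    show "AE z in lborel. z \<in> {1/b<..} \<longrightarrow> norm (?f z) \<le> norm (norm p * (1 / z^2))"
      using nrm by (intro AE_I2) auto
  qed
  have "(LBINT z=ereal (1/b)..\<infinity>. ?f z) = 0 - Ln (1 - b * (- p))"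
  proof (rule interval_integral_FTC_integrable[where F = ?F])
    fix x assume "ereal (1/b) < ereal x"
    hence x: "x > 0" using b by (smt (verit) divide_pos_pos less_ereal.simps(1))
    have "((\<lambda>z. Ln (1 + p / z)) has_field_derivative
            (inverse (1 + p / x)) * (- p / (x*x))) (at (complex_of_real x))"
      using nr[OF x] x by (auto intro!: derivative_eq_intros simp: field_simps)
    from has_vector_derivative_real_field[OF this]
    have "(?F has_vector_derivative (inverse (1 + p / x)) * (- p / (x*x))) (at x)" .
    also have "(inverse (1 + p / x)) * (- p / (x*x)) = ?f x" using x nz[OF x] by (simp add: field_simps)
    finally show "(?F has_vector_derivative ?f x) (at x)" .
    show "isCont ?f x" using x nz[OF x] by (auto intro!: continuous_intros)
  next
    show "set_integrable lborel (einterval (ereal (1/b)) \<infinity>) ?f"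
      using I by (simp add: ein)
    have c: "isCont ?F (1/b)" using nr[of "1/b"] b by (intro continuous_intros isCont_Ln') auto
    have "(?F \<longlongrightarrow> Ln (1 + p * b)) (at_right (1/b))"
      using c b by (auto simp: isCont_def intro: filterlim_at_split[THEN iffD1, THEN conjunct2])
    thus "((?F \<circ> real_of_ereal) \<longlongrightarrow> Ln (1 - b * (- p))) (at_right (ereal (1/b)))"
      by (simp add: ereal_tendsto_simps mult.commute)
    have "((\<lambda>z::real. 1 / z) \<longlongrightarrow> 0) at_top" by real_asymp
    hence "((\<lambda>z::real. 1 + p * of_real (1 / z)) \<longlongrightarrow> 1 + p * of_real 0) at_top"
      by (intro tendsto_intros)
    hence "((\<lambda>z::real. 1 + p / z) \<longlongrightarrow> 1) at_top" by simp
    hence "(?F \<longlongrightarrow> Ln 1) at_top" by (intro tendsto_Ln) auto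
    thus "((?F \<circ> real_of_ereal) \<longlongrightarrow> 0) (at_left \<infinity>)" by (simp add: ereal_tendsto_simps)
  qed simp
  moreover have "(LBINT z=ereal (1/b)..\<infinity>. ?f z) = (LBINT z:{1/b<..}. ?f z)"
    by (rule interval_integral_to_infinity_eq)
  ultimately have "(CLBINT z:{1/b<..}. ?f z) = - Ln (1 - b * (- p))" by simp
  with I show "set_integrable lborel {1/b<..} (\<lambda>z. 1 / complex_of_real z * (m / (complex_of_real z - m)))"
    and "(CLBINT z:{1/b<..}. 1 / complex_of_real z * (m / (complex_of_real z - m))) =
           - Ln (1 - complex_of_real b * m)"
    unfolding mp by blast+
qed

text \<open>
  The symbol of \<open>geometric_op\<close> is that of the integral of \<open>(1/z) D (z - D)^{-1}\<close> over
  \<open>z > 1/b\<close>.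
\<close>

lemma geometric_symbol_resolvent:
  assumes "b > 0" "0 < \<alpha>" "\<alpha> \<le> 2" "\<bar>\<theta>\<bar> \<le> min \<alpha> (2 - \<alpha>)"
  shows "(CLBINT z:{1/b<..}. 1 / complex_of_real z *
            (riesz_feller_adj_symbol \<alpha> \<theta> \<xi> / (complex_of_real z - riesz_feller_adj_symbol \<alpha> \<theta> \<xi>))) =
         - Ln (1 - complex_of_real b * riesz_feller_adj_symbol \<alpha> \<theta> \<xi>)"
  using Re_psi_nonneg[of \<alpha> \<theta> \<xi>] assms
  by (intro resolvent_integral_Ln(2)) (auto simp: riesz_feller_adj_symbol_def)

end

theory Submission
  imports Defs
begin

text \<open>
  The increment \<open>G r - G s\<close> has characteristic function
  \<open>\<phi> r \<xi> = exp (- integral {s..r} (\<lambda>z. ln (1 + b \<psi>\<^sub>z \<xi>)))\<close>, so Fourier inversion of \<open>f\<close> and Fubini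
  show that \<open>u x r\<close> is the inverse Fourier transform of \<open>\<phi> r \<cdot> fourier f\<close>. Since
  \<open>\<bar>\<phi>\<bar> \<le> 1\<close>, the logarithm grows at most like \<open>1 + \<xi>\<^sup>2\<close> and \<open>fourier f\<close> decays rapidly,
  one may differentiate in \<open>r\<close> under the integral; the derivative multiplies the integrand by
  \<open>- ln (1 + b \<psi>\<^sub>r \<xi>)\<close>, which is the symbol of the operator.
\<close>

section \<open>Majorants: integrability on products and differentiation under the integral\<close>

text \<open>Integrating the bound over the second variable leaves \<open>g x\<close> times a
  constant, which is integrable in \<open>x\<close>. This supplies the hypothesis of Fubini's
  theorem whenever the integrand splits up to factors of modulus 1.\<close>

lemma (in pair_sigma_finite) integrable_product_bound:
  fixes f :: "'a \<times> 'b \<Rightarrow> 'c::{banach, second_countable_topology}"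
    and g :: "'a \<Rightarrow> real" and h :: "'b \<Rightarrow> real"
  assumes f [measurable]: "f \<in> borel_measurable (M1 \<Otimes>\<^sub>M M2)"
    and g: "integrable M1 g" and h: "integrable M2 h"
    and bound: "\<And>x y. norm (f (x, y)) \<le> g x * h y"
  shows "integrable (M1 \<Otimes>\<^sub>M M2) f"
proof (rule Fubini_integrable[OF f])
  have 1: "integrable M2 (\<lambda>y. f (x, y))" if [measurable]: "x \<in> space M1" for x
  proof (rule Bochner_Integration.integrable_bound)
    show "integrable M2 (\<lambda>y. g x * h y)" using h by simp
    show "AE y in M2. norm (f (x, y)) \<le> norm (g x * h y)"
      using bound order_trans[OF _ abs_ge_self] by (intro AE_I2) auto
  qed measurable
  thus "AE x in M1. integrable M2 (\<lambda>y. f (x, y))" by (intro AE_I2) auto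
  show "integrable M1 (\<lambda>x. \<integral>y. norm (f (x, y)) \<partial>M2)"
  proof (rule Bochner_Integration.integrable_bound)
    show "integrable M1 (\<lambda>x. g x * (\<integral>y. h y \<partial>M2))" using g by simp
    show "AE x in M1. norm (\<integral>y. norm (f (x, y)) \<partial>M2) \<le> norm (g x * (\<integral>y. h y \<partial>M2))"
    proof (rule AE_I2)
      fix x assume "x \<in> space M1"
      have "(\<integral>y. norm (f (x, y)) \<partial>M2) \<le> (\<integral>y. g x * h y \<partial>M2)"
        using bound h 1[OF \<open>x \<in> space M1\<close>] by (intro integral_mono) auto
      moreover have "(\<integral>y. norm (f (x, y)) \<partial>M2) \<ge> 0" by simp
      ultimately show "norm (\<integral>y. norm (f (x, y)) \<partial>M2) \<le> norm (g x * (\<integral>y. h y \<partial>M2))"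
        by simp
    qed
  qed measurable
qed

text \<open>Dominated convergence applied to the normalised remainder of the first-order expansion
  at \<open>t\<close>. Working within a convex \<open>S\<close> includes one-sided derivatives at an
  endpoint.\<close>

lemma has_vector_derivative_integral:
  fixes \<Phi> D :: "real \<Rightarrow> 'b \<Rightarrow> 'c::{banach, second_countable_topology}"
  assumes S: "convex S" "t \<in> S"
    and int: "\<And>r. r \<in> S \<Longrightarrow> integrable M (\<Phi> r)"
    and D: "\<And>r x. r \<in> S \<Longrightarrow> ((\<lambda>r. \<Phi> r x) has_vector_derivative D r x) (at r within S)"
    and D_meas [measurable]: "D t \<in> borel_measurable M"
    and D_bound: "\<And>r x. r \<in> S \<Longrightarrow> norm (D r x) \<le> w x"
    and w: "integrable M w"
  shows "((\<lambda>r. \<integral>x. \<Phi> r x \<partial>M) has_vector_derivative (\<integral>x. D t x \<partial>M)) (at t within S)"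
proof -
  have D_int: "integrable M (D t)"
    by (rule Bochner_Integration.integrable_bound[OF w])
       (use D_bound[OF S(2)] order_trans[OF _ abs_ge_self] in auto)
  define q where "q r x = (1 / norm (r - t)) *\<^sub>R (\<Phi> r x - (\<Phi> t x + (r - t) *\<^sub>R D t x))" for r x
  have q_int: "integrable M (q r)" if "r \<in> S" for r
    using int[OF that] int[OF S(2)] D_int by (simp add: q_def[abs_def])
  \<comment> \<open>The factor 2 arises because the mean value inequality on \<open>S\<close> bounds
    the increment of \<open>\<Phi>\<close> by \<open>w x * norm (r - t)\<close>, and the linear term
    obeys the same bound.\<close>
  have q_bound: "norm (q r x) \<le> 2 * w x" if "r \<in> S" "r \<noteq> t" for r x
  proof -
    have "norm (\<Phi> r x - \<Phi> t x) \<le> w x * norm (r - t)"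
    proof (rule differentiable_bound[OF S(1) _ _ that(1) S(2)])
      fix z assume z: "z \<in> S"
      show "((\<lambda>r. \<Phi> r x) has_derivative (\<lambda>h. h *\<^sub>R D z x)) (at z within S)"
        using D[OF z] by (simp add: has_vector_derivative_def)
      show "onorm (\<lambda>h. h *\<^sub>R D z x) \<le> w x"
        using D_bound[OF z] by (simp add: onorm_scaleR_left onorm_id)
    qed
    moreover have "norm ((r - t) *\<^sub>R D t x) \<le> w x * norm (r - t)"
      using mult_right_mono[OF D_bound[OF S(2)], of "\<bar>r - t\<bar>"] by (simp add: mult.commute)
    ultimately have "norm (\<Phi> r x - (\<Phi> t x + (r - t) *\<^sub>R D t x)) \<le> 2 * w x * norm (r - t)"
      using norm_triangle_ineq4[of "\<Phi> r x - \<Phi> t x" "(r - t) *\<^sub>R D t x"]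
      by (simp add: diff_diff_eq)
    moreover have "norm (r - t) > 0" using that by simp
    moreover have "norm (q r x) = norm (\<Phi> r x - (\<Phi> t x + (r - t) *\<^sub>R D t x)) / norm (r - t)"
      unfolding q_def norm_scaleR by simp
    ultimately show ?thesis by (simp only: pos_divide_le_eq)
  qed
  have "((\<lambda>r. \<integral>x. q r x \<partial>M) \<longlongrightarrow> 0) (at t within S)"
  \<comment> \<open>Passing to sequences makes the sequential dominated convergence theorem
    applicable.\<close>
  proof (subst tendsto_at_iff_sequentially, intro allI impI)
    fix X assume X: "\<forall>i. X i \<in> S - {t}" "X \<longlonglongrightarrow> t"
    have "(\<lambda>i. \<integral>x. q (X i) x \<partial>M) \<longlonglongrightarrow> (\<integral>x. 0 \<partial>M)"
    proof (rule integral_dominated_convergence)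
      show "q (X i) \<in> borel_measurable M" for i using q_int X by auto
      show "integrable M (\<lambda>x. 2 * w x)" using w by simp
      show "AE x in M. norm (q (X i) x) \<le> 2 * w x" for i using q_bound X by auto
      show "AE x in M. (\<lambda>i. q (X i) x) \<longlonglongrightarrow> 0"
      proof (rule AE_I2)
        fix x
        have "((\<lambda>r. q r x) \<longlongrightarrow> 0) (at t within S)"
          using D[OF S(2)] by (simp add: q_def has_vector_derivative_def has_derivative_within)
        thus "(\<lambda>i. q (X i) x) \<longlonglongrightarrow> 0"
          using X by (auto simp: tendsto_at_iff_sequentially o_def)
      qed
    qed simp
    thus "((\<lambda>r. \<integral>x. q r x \<partial>M) \<circ> X) \<longlonglongrightarrow> 0" by (simp add: o_def)
  qed
  \<comment> \<open>Linearity of the integral needs \<open>\<Phi> r\<close> integrable, which is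
    known for \<open>r\<close> in \<open>S\<close> only; hence the equality is claimed
    eventually.\<close>
  moreover have "eventually (\<lambda>r. (\<integral>x. q r x \<partial>M) = (1 / norm (r - t)) *\<^sub>R
      ((\<integral>x. \<Phi> r x \<partial>M) - ((\<integral>x. \<Phi> t x \<partial>M) + (r - t) *\<^sub>R (\<integral>x. D t x \<partial>M)))) (at t within S)"
    using int int[OF S(2)] D_int by (auto simp: q_def eventually_at_filter)
  ultimately have "((\<lambda>r. (1 / norm (r - t)) *\<^sub>R
      ((\<integral>x. \<Phi> r x \<partial>M) - ((\<integral>x. \<Phi> t x \<partial>M) + (r - t) *\<^sub>R (\<integral>x. D t x \<partial>M)))) \<longlongrightarrow> 0) (at t within S)"
    by (rule Lim_transform_eventually)
  thus ?thesis
    unfolding has_vector_derivative_def has_derivative_within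
    by (simp add: bounded_linear_scaleR_left)
qed

subsection \<open>Schwartz functions and their Fourier transforms\<close>

lemma schwartz_derivative:
  assumes "schwartz f"
  obtains f' where "schwartz f'" "\<And>x. (f has_vector_derivative f' x) (at x)"
proof -
  from assms obtain F where F: "F 0 = f" "\<And>n x. (F n has_vector_derivative F (Suc n) x) (at x)"
    "\<And>m n. bounded (range (\<lambda>x. x ^ m *\<^sub>R F n x))"
    unfolding schwartz_def by blast
  have "schwartz (F 1)"
    unfolding schwartz_def using F(2,3) by (intro exI[of _ "\<lambda>n. F (Suc n)"]) auto
  thus ?thesis using that F(2)[of 0] F(1) by simp
qed

lemma continuous_on_schwartz: "schwartz f \<Longrightarrow> continuous_on A f"
  by (metis schwartz_derivative continuous_at_imp_continuous_on has_vector_derivative_continuous)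

lemma borel_measurable_schwartz: "schwartz f \<Longrightarrow> f \<in> borel_measurable borel"
  by (intro borel_measurable_continuous_onI continuous_on_schwartz)

lemma schwartz_bound:
  assumes "schwartz f"
  shows "\<exists>C. \<forall>x. \<bar>x\<bar> ^ m * norm (f x) \<le> C"
proof -
  from assms have "bounded (range (\<lambda>x. x ^ m *\<^sub>R f x))"
    unfolding schwartz_def by metis
  thus ?thesis by (auto simp: bounded_iff power_abs abs_mult)
qed

lemma schwartz_decay:
  assumes "schwartz f"
  shows "\<exists>C. \<forall>x. norm (f x) \<le> C * inverse (1 + x\<^sup>2)"
proof -
  obtain C0 where C0: "\<And>x. \<bar>x\<bar> ^ 0 * norm (f x) \<le> C0" using schwartz_bound[OF assms] by blast
  obtain C2 where C2: "\<And>x. \<bar>x\<bar> ^ 2 * norm (f x) \<le> C2" using schwartz_bound[OF assms] by blast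
  have "norm (f x) \<le> (C0 + C2) * inverse (1 + x\<^sup>2)" for x
  proof -
    have "1 + x\<^sup>2 > 0" by (simp add: add_pos_nonneg)
    moreover have "norm (f x) * (1 + x\<^sup>2) \<le> C0 + C2"
      using C0[of x] C2[of x] by (simp add: algebra_simps)
    ultimately show ?thesis by (simp add: field_simps)
  qed
  thus ?thesis by blast
qed

lemma integrable_inverse_1_plus_square_lborel: "integrable lborel (\<lambda>x::real. inverse (1 + x\<^sup>2))"
  using integrable_inverse_1_plus_square by (simp add: set_integrable_def)

lemma integrable_schwartz:
  assumes "schwartz f"
  shows "integrable lborel f"
proof -
  obtain C where C: "\<And>x. norm (f x) \<le> C * inverse (1 + x\<^sup>2)" using schwartz_decay[OF assms] by blast
  show ?thesis
  proof (rule Bochner_Integration.integrable_bound)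
    show "integrable lborel (\<lambda>x. C * inverse (1 + x\<^sup>2))"
      using integrable_inverse_1_plus_square_lborel by simp
    show "AE x in lborel. norm (f x) \<le> norm (C * inverse (1 + x\<^sup>2))"
      using C order_trans[OF _ abs_ge_self] by (intro AE_I2) auto
  qed (use borel_measurable_schwartz[OF assms] in simp)
qed

lemma schwartz_tendsto_0:
  assumes "schwartz f"
  shows "(f \<longlongrightarrow> 0) at_top" "(f \<longlongrightarrow> 0) at_bot"
proof -
  obtain C where C: "\<And>x. norm (f x) \<le> C * inverse (1 + x\<^sup>2)" using schwartz_decay[OF assms] by blast
  have "((\<lambda>x::real. C * inverse (1 + x\<^sup>2)) \<longlongrightarrow> 0) at_top" by real_asymp
  thus "(f \<longlongrightarrow> 0) at_top" by (rule Lim_null_comparison[rotated]) (use C in auto)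
  have "((\<lambda>x::real. C * inverse (1 + x\<^sup>2)) \<longlongrightarrow> 0) at_bot" by real_asymp
  thus "(f \<longlongrightarrow> 0) at_bot" by (rule Lim_null_comparison[rotated]) (use C in auto)
qed

lemma integrable_iexp_mult:
  fixes f :: "'b \<Rightarrow> complex"
  assumes "integrable M f" "g \<in> borel_measurable M"
  shows "integrable M (\<lambda>x. iexp (g x) * f x)"
  by (rule Bochner_Integration.integrable_bound[OF assms(1)])
     (use assms in \<open>auto simp: norm_mult intro!: borel_measurable_times borel_measurable_exp\<close>)

text \<open>Integration by parts: \<open>?h\<close> is the derivative of \<open>?e x * f x\<close>,
  which tends to 0 at both ends of the line, so the integral of \<open>?h\<close> vanishes.\<close>

lemma fourier_derivative:
  assumes f: "schwartz f" and f': "schwartz f'" "\<And>x. (f has_vector_derivative f' x) (at x)"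
  shows "fourier f' \<xi> = \<i> * \<xi> * fourier f \<xi>"
proof -
  let ?e = "\<lambda>x::real. iexp (- (\<xi> * x))"
  let ?h = "\<lambda>x::real. ?e x * f' x - \<i> * \<xi> * (?e x * f x)"
  have int: "integrable lborel (\<lambda>x. ?e x * f x)" "integrable lborel (\<lambda>x. ?e x * f' x)"
    by (intro integrable_iexp_mult integrable_schwartz f f'(1); measurable)+
  have 0: "((\<lambda>x. ?e x * f x) \<longlongrightarrow> 0) F" if "(f \<longlongrightarrow> 0) F" for F
    using tendsto_norm_zero[OF that]
    by (intro tendsto_norm_zero_cancel[of "\<lambda>x. ?e x * f x"]) (simp add: norm_mult)
  have "(LBINT x=-\<infinity>..\<infinity>. ?h x) = 0 - 0"
  proof (rule interval_integral_FTC_integrable[where F = "\<lambda>x. ?e x * f x"])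
    fix x
    have "((\<lambda>z. exp (\<i> * - (\<xi> * z))) has_field_derivative (exp (\<i> * - (\<xi> * x)) * (- \<i> * \<xi>))) (at (complex_of_real x))"
      by (auto intro!: derivative_eq_intros)
    from has_vector_derivative_real_field[OF this]
    have "(?e has_vector_derivative (?e x * (- \<i> * \<xi>))) (at x)" by simp
    from has_vector_derivative_mult[OF this f'(2)]
    show "((\<lambda>x. ?e x * f x) has_vector_derivative ?h x) (at x)"
      by (simp add: algebra_simps)
    have "isCont f x" "isCont f' x"
      using continuous_on_schwartz[OF f, of UNIV] continuous_on_schwartz[OF f'(1), of UNIV]
      by (auto simp: continuous_on_eq_continuous_at)
    thus "isCont ?h x" by (intro continuous_intros)
  next
    show "set_integrable lborel (einterval (-\<infinity>) \<infinity>) ?h"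
      using int by (simp add: set_integrable_def)
  qed (use 0[OF schwartz_tendsto_0(1)[OF f]] 0[OF schwartz_tendsto_0(2)[OF f]]
      in \<open>simp_all add: ereal_tendsto_simps\<close>)
  hence "(CLBINT x. ?h x) = 0"
    by (simp add: interval_lebesgue_integral_def set_lebesgue_integral_def)
  thus ?thesis using int by (simp add: fourier_def)
qed

lemma norm_fourier_le:
  "norm (fourier f \<xi>) \<le> 1 / sqrt (2 * pi) * (\<integral>x. norm (f x) \<partial>lborel)"
proof -
  have "norm (CLBINT x. iexp (- (\<xi> * x)) * f x) \<le> (\<integral>x. norm (iexp (- (\<xi> * x)) * f x) \<partial>lborel)"
    by (rule integral_norm_bound)
  thus ?thesis by (simp add: fourier_def norm_mult norm_divide divide_right_mono)
qed

text \<open>Each factor of \<xi> is traded for a derivative of \<open>f\<close>, which is again a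
  Schwartz function; after \<open>m\<close> trades the L1 bound \<open>norm_fourier_le\<close>
  applies. Hence the induction varies \<open>f\<close>.\<close>

lemma fourier_schwartz_bound:
  assumes "schwartz f"
  shows "\<exists>C. \<forall>\<xi>. \<bar>\<xi>\<bar> ^ m * norm (fourier f \<xi>) \<le> C"
  using assms
proof (induction m arbitrary: f)
  case 0
  thus ?case using norm_fourier_le[of f] by auto
next
  case (Suc m)
  obtain f' where f': "schwartz f'" "\<And>x. (f has_vector_derivative f' x) (at x)"
    by (rule schwartz_derivative[OF Suc.prems]) blast
  from Suc.IH[OF f'(1)] show ?case
    by (simp add: fourier_derivative[OF Suc.prems f'] norm_mult mult_ac)
qed

text \<open>The weight on the left will absorb the quadratic growth of the logarithmic symbol; the
  right-hand side is still integrable.\<close>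

lemma fourier_schwartz_decay:
  assumes "schwartz f"
  shows "\<exists>C. \<forall>\<xi>. (1 + \<xi>\<^sup>2) * norm (fourier f \<xi>) \<le> C * inverse (1 + \<xi>\<^sup>2)"
proof -
  obtain C0 where C0: "\<And>\<xi>. \<bar>\<xi>\<bar> ^ 0 * norm (fourier f \<xi>) \<le> C0"
    using fourier_schwartz_bound[OF assms] by blast
  obtain C2 where C2: "\<And>\<xi>. \<bar>\<xi>\<bar> ^ 2 * norm (fourier f \<xi>) \<le> C2"
    using fourier_schwartz_bound[OF assms] by blast
  obtain C4 where C4: "\<And>\<xi>. \<bar>\<xi>\<bar> ^ 4 * norm (fourier f \<xi>) \<le> C4"
    using fourier_schwartz_bound[OF assms] by blast
  \<comment> \<open>The constant follows the expansion of \<open>(1 + \<xi>\<^sup>2)\<^sup>2\<close>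
    into powers 0, 2 and 4.\<close>
  have "(1 + \<xi>\<^sup>2) * norm (fourier f \<xi>) \<le> (C0 + 2 * C2 + C4) * inverse (1 + \<xi>\<^sup>2)" for \<xi>
  proof -
    have "(1 + \<xi>\<^sup>2) * norm (fourier f \<xi>) * (1 + \<xi>\<^sup>2) =
      norm (fourier f \<xi>) + 2 * (\<xi>\<^sup>2 * norm (fourier f \<xi>)) + \<xi> ^ 4 * norm (fourier f \<xi>)"
      by (simp add: algebra_simps power2_eq_square power4_eq_xxxx)
    also have "\<dots> \<le> C0 + 2 * C2 + C4"
      using C0[of \<xi>] C2[of \<xi>] C4[of \<xi>] by simp
    finally show ?thesis
      by (simp add: divide_inverse[symmetric] pos_le_divide_eq add_pos_nonneg)
  qed
  thus ?thesis by blast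
qed

lemma borel_measurable_fourier:
  assumes [measurable]: "f \<in> borel_measurable borel"
  shows "fourier f \<in> borel_measurable borel"
  unfolding fourier_def[abs_def] by measurable

lemma integrable_fourier_schwartz:
  assumes "schwartz f"
  shows "integrable lborel (\<lambda>\<xi>. (1 + \<xi>\<^sup>2) * norm (fourier f \<xi>))" (is ?th1)
    and "integrable lborel (fourier f)" (is ?th2)
proof -
  note [measurable] = borel_measurable_fourier[OF borel_measurable_schwartz[OF assms]]
  obtain C where C: "\<And>\<xi>. (1 + \<xi>\<^sup>2) * norm (fourier f \<xi>) \<le> C * inverse (1 + \<xi>\<^sup>2)"
    using fourier_schwartz_decay[OF assms] by blast
  show ?th1
  proof (rule Bochner_Integration.integrable_bound)
    show "integrable lborel (\<lambda>x. C * inverse (1 + x\<^sup>2))"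
      using integrable_inverse_1_plus_square_lborel by simp
    show "AE \<xi> in lborel. norm ((1 + \<xi>\<^sup>2) * norm (fourier f \<xi>)) \<le> norm (C * inverse (1 + \<xi>\<^sup>2))"
      using C order_trans[OF _ abs_ge_self] by (intro AE_I2) auto
  qed measurable
  thus ?th2
    by (rule Bochner_Integration.integrable_bound)
       (auto simp: borel_measurable_fourier borel_measurable_schwartz assms distrib_right)
qed

subsection \<open>Fourier inversion\<close>

lemma integrable_gaussian: "integrable lborel (\<lambda>x::real. exp (- x\<^sup>2 / 2))"
  using integrable_mult_right[OF integrable_normal_moment[where \<mu> = 0 and \<sigma> = 1 and k = 0], of "sqrt (2 * pi)"]
  by (simp add: std_normal_density_def)

text \<open>This is the characteristic function of the standard normal distribution, with the
  normalising factor of the density moved across.\<close>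

lemma integral_gaussian_iexp:
  "(CLBINT x. iexp (c * x) * exp (- x\<^sup>2 / 2)) = sqrt (2 * pi) * exp (- c\<^sup>2 / 2)"
proof -
  have "complex_of_real (exp (- c\<^sup>2 / 2)) = (CLBINT x. std_normal_density x *\<^sub>R iexp (c * x))"
    unfolding fun_cong[OF char_std_normal_distribution, of c, symmetric] char_def
    by (subst integral_density) auto
  also have "\<dots> = (CLBINT x. complex_of_real (1 / sqrt (2 * pi)) * (iexp (c * x) * exp (- x\<^sup>2 / 2)))"
    by (intro Bochner_Integration.integral_cong) (auto simp: std_normal_density_def scaleR_conv_of_real)
  also have "\<dots> = complex_of_real (1 / sqrt (2 * pi)) * (CLBINT x. iexp (c * x) * exp (- x\<^sup>2 / 2))"
    by (rule integral_mult_right_zero)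
  finally show ?thesis by (simp add: field_simps)
qed

text \<open>Inserting the Gaussian weight makes the double integral absolutely convergent.\<close>

lemma fourier_gaussian_mean:
  assumes f: "schwartz f" and n: "n > 0"
  shows "(CLBINT \<xi>. iexp (\<xi> * x) * fourier f \<xi> * complex_of_real (exp (- (\<xi> / n)\<^sup>2 / 2))) =
         (CLBINT v. f (x + v / n) * complex_of_real (exp (- v\<^sup>2 / 2)))"
proof -
  note [measurable] = borel_measurable_schwartz[OF f]
  let ?c = "complex_of_real (1 / sqrt (2 * pi))"
  let ?w = "\<lambda>\<xi>::real. exp (- (\<xi> / n)\<^sup>2 / 2)"
  have w: "integrable lborel ?w"
    using lborel_integrable_real_affine[OF integrable_gaussian, of "1 / n" 0] n by simp
  \<comment> \<open>Replacing \<xi> by \<open>n * \<xi>\<close> reduces the weight to the standard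
    Gaussian: a wide weight in \<xi> has a narrow transform in \<open>u\<close>.\<close>
  have kernel: "(CLBINT \<xi>. iexp (\<xi> * u) * ?w \<xi>) = n * (sqrt (2 * pi) * exp (- (n * u)\<^sup>2 / 2))" for u
  proof -
    have "(CLBINT \<xi>. iexp (\<xi> * u) * ?w \<xi>) =
        \<bar>n\<bar> *\<^sub>R (CLBINT \<xi>. iexp ((0 + n * \<xi>) * u) * ?w (0 + n * \<xi>))"
      using n by (intro lborel_integral_real_affine) auto
    also have "\<dots> = n *\<^sub>R (CLBINT \<xi>. iexp ((n * u) * \<xi>) * exp (- \<xi>\<^sup>2 / 2))"
      using n by (simp add: mult_ac)
    finally show ?thesis
      unfolding integral_gaussian_iexp by (simp add: scaleR_conv_of_real)
  qed
  have "(CLBINT \<xi>. iexp (\<xi> * x) * fourier f \<xi> * ?w \<xi>) =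
      (CLBINT \<xi>. ?c * (CLBINT y. iexp (\<xi> * (x - y)) * f y * ?w \<xi>))"
  proof (intro Bochner_Integration.integral_cong refl)
    fix \<xi>
    have "(CLBINT y. iexp (\<xi> * (x - y)) * f y * ?w \<xi>) =
        (CLBINT y. iexp (\<xi> * x) * ?w \<xi> * (iexp (- (\<xi> * y)) * f y))"
      by (intro Bochner_Integration.integral_cong refl)
         (simp add: algebra_simps flip: exp_add)
    also have "\<dots> = iexp (\<xi> * x) * ?w \<xi> * (CLBINT y. iexp (- (\<xi> * y)) * f y)"
      by (rule integral_mult_right_zero)
    finally show "iexp (\<xi> * x) * fourier f \<xi> * ?w \<xi> = ?c * (CLBINT y. iexp (\<xi> * (x - y)) * f y * ?w \<xi>)"
      by (simp add: fourier_def mult_ac)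
  qed
  also have "\<dots> = ?c * (CLBINT \<xi>. CLBINT y. iexp (\<xi> * (x - y)) * f y * ?w \<xi>)"
    by (rule integral_mult_right_zero)
  also have "(CLBINT \<xi>. CLBINT y. iexp (\<xi> * (x - y)) * f y * ?w \<xi>) =
      (CLBINT y. CLBINT \<xi>. iexp (\<xi> * (x - y)) * f y * ?w \<xi>)"
  proof (rule lborel_pair.Fubini_integral)
    show "integrable (lborel \<Otimes>\<^sub>M lborel) (\<lambda>(y, \<xi>). iexp (\<xi> * (x - y)) * f y * ?w \<xi>)"
    proof (rule lborel_pair.integrable_product_bound)
      show "integrable lborel (\<lambda>y. norm (f y))" using integrable_schwartz[OF f] by simp
      show "integrable lborel ?w" by (rule w)
    qed (auto simp: norm_mult)
  qed
  also have "\<dots> = (CLBINT y. f y * (CLBINT \<xi>. iexp (\<xi> * (x - y)) * ?w \<xi>))"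
    by (subst integral_mult_right_zero[symmetric]) (simp add: mult_ac)
  also have "\<dots> = (CLBINT y. (n * sqrt (2 * pi)) * (f y * exp (- (n * (x - y))\<^sup>2 / 2)))"
    unfolding kernel by (simp add: mult_ac)
  also have "\<dots> = (n * sqrt (2 * pi)) * (CLBINT y. f y * exp (- (n * (x - y))\<^sup>2 / 2))"
    by (rule integral_mult_right_zero)
  \<comment> \<open>The substitution \<open>y = x + v / n\<close> fixes the Gaussian and moves
    \<open>n\<close> into the argument of \<open>f\<close>; its factor \<open>1 / n\<close> cancels
    the \<open>n\<close> of the kernel.\<close>
  also have "(CLBINT y. f y * exp (- (n * (x - y))\<^sup>2 / 2)) =
      \<bar>1 / n\<bar> *\<^sub>R (CLBINT v. f (x + 1 / n * v) * exp (- (n * (x - (x + 1 / n * v)))\<^sup>2 / 2))"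
    using n by (intro lborel_integral_real_affine) auto
  also have "\<dots> = complex_of_real (1 / n) * (CLBINT v. f (x + v / n) * complex_of_real (exp (- v\<^sup>2 / 2)))"
    using n by (simp add: scaleR_conv_of_real)
  finally show ?thesis using n by (simp add: field_simps)
qed

text \<open>Let \<open>n\<close> tend to infinity in \<open>fourier_gaussian_mean\<close>. On the
  left the weight tends to 1, with majorant \<open>norm (fourier f \<xi>)\<close>; on the right
  \<open>f (x + v / n)\<close> tends to \<open>f x\<close>, with a Gaussian majorant. The remaining
  Gaussian integral cancels the normalisation.\<close>

theorem fourier_inversion:
  assumes f: "schwartz f"
  shows "inverse_fourier (fourier f) x = f x"
proof -
  note [measurable] = borel_measurable_schwartz[OF f] borel_measurable_fourier
  have "(\<lambda>n. CLBINT \<xi>. iexp (\<xi> * x) * fourier f \<xi> * complex_of_real (exp (- (\<xi> / Suc n)\<^sup>2 / 2)))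
      \<longlonglongrightarrow> (CLBINT \<xi>. iexp (\<xi> * x) * fourier f \<xi>)"
  proof (rule integral_dominated_convergence)
    show "integrable lborel (\<lambda>\<xi>. norm (fourier f \<xi>))"
      using integrable_fourier_schwartz(2)[OF f] by simp
    show "AE \<xi> in lborel. (\<lambda>n. iexp (\<xi> * x) * fourier f \<xi> * complex_of_real (exp (- (\<xi> / Suc n)\<^sup>2 / 2)))
        \<longlonglongrightarrow> iexp (\<xi> * x) * fourier f \<xi>"
    proof (rule AE_I2)
      fix \<xi> :: real
      have "(\<lambda>n. exp (- (\<xi> / Suc n)\<^sup>2 / 2)) \<longlonglongrightarrow> exp (- 0\<^sup>2 / 2)"
        by (intro tendsto_intros LIMSEQ_Suc[OF lim_const_over_n]) auto
      hence "(\<lambda>n. exp (- (\<xi> / Suc n)\<^sup>2 / 2)) \<longlonglongrightarrow> 1" by simp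
      from tendsto_mult_left[OF tendsto_of_real[OF this], of "iexp (\<xi> * x) * fourier f \<xi>"]
      show "(\<lambda>n. iexp (\<xi> * x) * fourier f \<xi> * complex_of_real (exp (- (\<xi> / Suc n)\<^sup>2 / 2)))
          \<longlonglongrightarrow> iexp (\<xi> * x) * fourier f \<xi>" by simp
    qed
  qed (auto simp: norm_mult mult_left_le)
  moreover have "(\<lambda>n. CLBINT v. f (x + v / Suc n) * complex_of_real (exp (- v\<^sup>2 / 2)))
      \<longlonglongrightarrow> (CLBINT v. f x * complex_of_real (exp (- v\<^sup>2 / 2)))"
  proof -
    \<comment> \<open>The exponent 0 turns the Schwartz estimate into plain boundedness of
      \<open>f\<close>.\<close>
    obtain C where C: "\<And>x. \<bar>x\<bar> ^ 0 * norm (f x) \<le> C" using schwartz_bound[OF f] by blast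
    show ?thesis
    proof (rule integral_dominated_convergence)
      show "integrable lborel (\<lambda>v::real. C * exp (- v\<^sup>2 / 2))" using integrable_gaussian by simp
      show "AE v in lborel. (\<lambda>n. f (x + v / Suc n) * complex_of_real (exp (- v\<^sup>2 / 2))) \<longlonglongrightarrow> f x * complex_of_real (exp (- v\<^sup>2 / 2))"
      proof (rule AE_I2)
        fix v :: real
        have "isCont f x"
          using continuous_on_schwartz[OF f, of UNIV] by (simp add: continuous_on_eq_continuous_at)
        moreover have "(\<lambda>n. x + v / Suc n) \<longlonglongrightarrow> x" by real_asymp
        ultimately have "(\<lambda>n. f (x + v / Suc n)) \<longlonglongrightarrow> f x" by (rule isCont_tendsto_compose)
        thus "(\<lambda>n. f (x + v / Suc n) * complex_of_real (exp (- v\<^sup>2 / 2))) \<longlonglongrightarrow> f x * complex_of_real (exp (- v\<^sup>2 / 2))"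
          by (intro tendsto_intros)
      qed
    qed (use C in \<open>auto simp: norm_mult\<close>)
  qed
  ultimately have "(CLBINT \<xi>. iexp (\<xi> * x) * fourier f \<xi>) = (CLBINT v. f x * complex_of_real (exp (- v\<^sup>2 / 2)))"
    unfolding fourier_gaussian_mean[OF f of_nat_0_less_iff[THEN iffD2, OF zero_less_Suc]]
    by (rule LIMSEQ_unique)
  also have "\<dots> = f x * (CLBINT v. complex_of_real (exp (- v\<^sup>2 / 2)))"
    by (rule integral_mult_right_zero)
  also have "(CLBINT v. complex_of_real (exp (- v\<^sup>2 / 2))) = sqrt (2 * pi)"
    using integral_gaussian_iexp[of 0] by simp
  finally show ?thesis by (simp add: inverse_fourier_def)
qed

section \<open>Fourier representation of the expectation of a randomly shifted function\<close>

context prob_space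
begin

text \<open>A translation by \<open>Y \<omega>\<close> multiplies the Fourier transform by
  \<open>iexp (\<xi> * Y \<omega>)\<close>, and Fubini lets the expectation act on that factor
  alone.\<close>

lemma fourier_expectation_shift:
  assumes Y [measurable]: "Y \<in> borel_measurable M" and f: "schwartz f"
  shows "fourier (\<lambda>x. CLINT \<omega>|M. f (x + Y \<omega>)) \<xi> = (CLINT \<omega>|M. iexp (\<xi> * Y \<omega>)) * fourier f \<xi>"
proof -
  note [measurable] = borel_measurable_schwartz[OF f]
  interpret pair_sigma_finite M lborel
    by (intro pair_sigma_finite.intro sigma_finite_measure_axioms sigma_finite_lborel)
  have shift_int: "integrable lborel (\<lambda>x. f (x + y))" for y
    using lborel_integrable_real_affine[OF integrable_schwartz[OF f], of 1 y] by (simp add: add.commute)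
  have "(CLBINT x. iexp (- (\<xi> * x)) * (CLINT \<omega>|M. f (x + Y \<omega>))) =
      (CLBINT x. (CLINT \<omega>|M. iexp (- (\<xi> * x)) * f (x + Y \<omega>)))"
    by (subst integral_mult_right_zero) simp
  also have "\<dots> = (CLINT \<omega>|M. CLBINT x. iexp (- (\<xi> * x)) * f (x + Y \<omega>))"
  proof (rule Fubini_integral, rule Fubini_integrable)
    \<comment> \<open>By translation invariance the inner integral of the norm is constant in
      \<omega>, hence integrable over a probability space.\<close>
    have "(\<integral>x. norm (f (x + y)) \<partial>lborel) = (\<integral>x. norm (f x) \<partial>lborel)" for y
      by (subst (2) lborel_integral_real_affine[where c = 1 and t = y]) (simp_all add: add.commute)
    thus "integrable M (\<lambda>\<omega>. \<integral>x. norm (case (\<omega>, x) of (\<omega>, x) \<Rightarrow> iexp (- (\<xi> * x)) * f (x + Y \<omega>)) \<partial>lborel)"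
      by (simp add: norm_mult)
    show "AE \<omega> in M. complex_integrable lborel
        (\<lambda>x. case (\<omega>, x) of (\<omega>, x) \<Rightarrow> iexp (- (\<xi> * x)) * f (x + Y \<omega>))"
      unfolding prod.case by (intro AE_I2 integrable_iexp_mult shift_int) simp
  qed measurable
  also have "\<dots> = (CLINT \<omega>|M. iexp (\<xi> * Y \<omega>) * (CLBINT x. iexp (- (\<xi> * x)) * f x))"
  proof (intro Bochner_Integration.integral_cong refl)
    fix \<omega>
    have "iexp (\<xi> * Y \<omega>) * (CLBINT x. iexp (- (\<xi> * x)) * f x) =
        (CLBINT x. iexp (\<xi> * Y \<omega>) * (iexp (- (\<xi> * x)) * f x))"
      by (rule integral_mult_right_zero[symmetric])
    also have "\<dots> = (CLBINT x. iexp (- (\<xi> * (x - Y \<omega>))) * f x)"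
      by (intro Bochner_Integration.integral_cong refl) (simp add: algebra_simps flip: exp_add)
    also have "\<dots> = \<bar>1\<bar> *\<^sub>R (CLBINT x. iexp (- (\<xi> * ((Y \<omega> + 1 * x) - Y \<omega>))) * f (Y \<omega> + 1 * x))"
      by (rule lborel_integral_real_affine) simp
    finally show "(CLBINT x. iexp (- (\<xi> * x)) * f (x + Y \<omega>)) =
        iexp (\<xi> * Y \<omega>) * (CLBINT x. iexp (- (\<xi> * x)) * f x)"
      by (simp add: add.commute)
  qed
  also have "\<dots> = (CLINT \<omega>|M. iexp (\<xi> * Y \<omega>)) * (CLBINT x. iexp (- (\<xi> * x)) * f x)"
    by (rule integral_mult_left_zero)
  finally show ?thesis by (simp add: fourier_def)
qed

text \<open>\<open>f\<close> is written by Fourier inversion inside the expectation and the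
  integrals are exchanged; the product majorant is 1 in \<omega> times
  \<open>norm (fourier f \<xi>)\<close>.\<close>

lemma expectation_shift_eq_inverse_fourier:
  assumes Y [measurable]: "Y \<in> borel_measurable M" and f: "schwartz f"
  shows "(CLINT \<omega>|M. f (x + Y \<omega>)) =
         inverse_fourier (\<lambda>\<xi>. (CLINT \<omega>|M. iexp (\<xi> * Y \<omega>)) * fourier f \<xi>) x"
proof -
  note [measurable] = borel_measurable_schwartz[OF f] borel_measurable_fourier
  interpret pair_sigma_finite M lborel
    by (intro pair_sigma_finite.intro sigma_finite_measure_axioms sigma_finite_lborel)
  let ?c = "complex_of_real (1 / sqrt (2 * pi))"
  have "(CLINT \<omega>|M. f (x + Y \<omega>)) =
      (CLINT \<omega>|M. ?c * (CLBINT \<xi>. iexp (\<xi> * (x + Y \<omega>)) * fourier f \<xi>))"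
    by (subst fourier_inversion[OF f, symmetric]) (simp add: inverse_fourier_def)
  also have "\<dots> = ?c * (CLINT \<omega>|M. CLBINT \<xi>. iexp (\<xi> * (x + Y \<omega>)) * fourier f \<xi>)"
    by (rule integral_mult_right_zero)
  also have "(CLINT \<omega>|M. CLBINT \<xi>. iexp (\<xi> * (x + Y \<omega>)) * fourier f \<xi>) =
      (CLBINT \<xi>. (CLINT \<omega>|M. iexp (\<xi> * (x + Y \<omega>)) * fourier f \<xi>))"
  proof (rule Fubini_integral[symmetric], rule integrable_product_bound)
    show "integrable M (\<lambda>_. 1::real)" by simp
    show "integrable lborel (\<lambda>\<xi>. norm (fourier f \<xi>))"
      using integrable_fourier_schwartz(2)[OF f] by simp
  qed (auto simp: norm_mult)
  also have "\<dots> = (CLBINT \<xi>. iexp (\<xi> * x) * ((CLINT \<omega>|M. iexp (\<xi> * Y \<omega>)) * fourier f \<xi>))"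
  proof (intro Bochner_Integration.integral_cong refl)
    fix \<xi>
    have "(CLINT \<omega>|M. iexp (\<xi> * (x + Y \<omega>)) * fourier f \<xi>) =
        (CLINT \<omega>|M. (iexp (\<xi> * x) * fourier f \<xi>) * iexp (\<xi> * Y \<omega>))"
      by (intro Bochner_Integration.integral_cong refl) (simp add: distrib_left exp_add)
    also have "\<dots> = (iexp (\<xi> * x) * fourier f \<xi>) * (CLINT \<omega>|M. iexp (\<xi> * Y \<omega>))"
      by (rule integral_mult_right_zero)
    finally show "(CLINT \<omega>|M. iexp (\<xi> * (x + Y \<omega>)) * fourier f \<xi>) =
        iexp (\<xi> * x) * ((CLINT \<omega>|M. iexp (\<xi> * Y \<omega>)) * fourier f \<xi>)"
      by (simp add: mult_ac)
  qed
  finally show ?thesis by (simp add: inverse_fourier_def)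
qed

lemma norm_expectation_iexp_le: "norm (CLINT \<omega>|M. iexp (Y \<omega>)) \<le> 1"
  using integral_norm_bound[of M "\<lambda>\<omega>. iexp (Y \<omega>)"] by (simp add: prob_space)

end

subsection \<open>The logarithmic symbol\<close>

text \<open>One function in two roles: the integrand in the exponent of the characteristic function
  of the process, and the negative of the symbol of \<open>geometric_op\<close>.\<close>

definition log_symbol :: "real \<Rightarrow> real \<Rightarrow> real \<Rightarrow> real \<Rightarrow> complex" where
  "log_symbol b \<alpha> \<theta> \<xi> = Ln (1 + complex_of_real b * psi \<alpha> \<theta> \<xi>)"

lemma log_symbol_0 [simp]: "log_symbol b \<alpha> \<theta> 0 = 0"
  by (simp add: log_symbol_def psi_def)

text \<open>The real part of \<open>Ln w\<close> is \<open>ln (norm w)\<close>, between 0 and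
  \<open>norm w - 1\<close>; the imaginary part of the principal branch is at most pi in
  modulus.\<close>

lemma norm_Ln_le:
  assumes "Re w \<ge> 1"
  shows "norm (Ln w) \<le> norm w - 1 + pi"
proof -
  have "norm w \<ge> 1" using assms complex_Re_le_cmod[of w] by linarith
  hence "w \<noteq> 0" by auto
  have "norm (Ln w) \<le> \<bar>Re (Ln w)\<bar> + \<bar>Im (Ln w)\<bar>" by (rule cmod_le)
  also have "\<bar>Re (Ln w)\<bar> \<le> norm w - 1"
    using \<open>norm w \<ge> 1\<close> \<open>w \<noteq> 0\<close> ln_le_minus_one[of "norm w"] by (simp add: Re_Ln)
  also have "\<bar>Im (Ln w)\<bar> \<le> pi"
    using Im_Ln_le_pi[OF \<open>w \<noteq> 0\<close>] mpi_less_Im_Ln[OF \<open>w \<noteq> 0\<close>] by linarith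
  finally show ?thesis by simp
qed

lemma norm_psi: "norm (psi \<alpha> \<theta> \<xi>) = \<bar>\<xi>\<bar> powr \<alpha>"
  by (simp add: psi_def norm_mult)

lemma abs_powr_le:
  assumes "0 < \<alpha>" "\<alpha> \<le> 2"
  shows "\<bar>\<xi>\<bar> powr \<alpha> \<le> 1 + (\<xi>::real)\<^sup>2"
proof (cases "\<bar>\<xi>\<bar> \<le> 1")
  case True
  have "\<bar>\<xi>\<bar> powr \<alpha> \<le> 1 powr \<alpha>" using True assms by (intro powr_mono2) auto
  thus ?thesis by (simp add: add_increasing2)
next
  case False
  have "\<bar>\<xi>\<bar> powr \<alpha> \<le> \<bar>\<xi>\<bar> powr 2" using False assms by (intro powr_mono) auto
  also have "\<dots> = \<xi>\<^sup>2" using False by (subst powr_numeral) auto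
  finally show ?thesis by simp
qed

text \<open>The bound is free of \<alpha> and \<theta>, hence uniform in time once these vary, as a
  majorant for differentiation in time must be.\<close>

lemma norm_log_symbol_le:
  assumes "b > 0" "0 < \<alpha>" "\<alpha> \<le> 2" "\<bar>\<theta>\<bar> \<le> min \<alpha> (2 - \<alpha>)"
  shows "norm (log_symbol b \<alpha> \<theta> \<xi>) \<le> (b + pi) * (1 + \<xi>\<^sup>2)"
proof -
  have "norm (log_symbol b \<alpha> \<theta> \<xi>) \<le> norm (1 + complex_of_real b * psi \<alpha> \<theta> \<xi>) - 1 + pi"
    unfolding log_symbol_def using assms Re_psi_nonneg[of \<alpha> \<theta> \<xi>] by (intro norm_Ln_le) simp
  also have "\<dots> \<le> b * \<bar>\<xi>\<bar> powr \<alpha> + pi"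
    using norm_triangle_ineq[of 1 "complex_of_real b * psi \<alpha> \<theta> \<xi>"] assms
    by (simp add: norm_mult norm_psi)
  also have "\<dots> \<le> b * (1 + \<xi>\<^sup>2) + pi * (1 + \<xi>\<^sup>2)"
    using assms abs_powr_le[of \<alpha> \<xi>] by (intro add_mono mult_left_mono) auto
  finally show ?thesis by (simp add: distrib_right)
qed

text \<open>\<open>Ln\<close> is continuous away from its branch cut. Cutting it off outside the
  open right half-plane gives a Borel function, and the argument \<open>?g\<close> always lies in
  that half-plane.\<close>

lemma borel_measurable_log_symbol:
  assumes "b > 0" "0 < \<alpha>" "\<alpha> \<le> 2" "\<bar>\<theta>\<bar> \<le> min \<alpha> (2 - \<alpha>)"
  shows "log_symbol b \<alpha> \<theta> \<in> borel_measurable borel"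
proof -
  let ?g = "\<lambda>\<xi>. 1 + complex_of_real b * psi \<alpha> \<theta> \<xi>"
  have sgn: "sgn = (\<lambda>x::real. if x > 0 then 1 else if x < 0 then -1 else 0)"
    by (auto simp: sgn_if)
  have [measurable]: "(sgn :: real \<Rightarrow> real) \<in> borel_measurable borel"
    unfolding sgn by measurable
  have [measurable]: "?g \<in> borel_measurable borel"
    unfolding psi_def by measurable
  have open_half_plane: "open {w::complex. Re w > 0}" by (rule open_halfspace_Re_gt)
  have "(\<lambda>w. indicator {w. Re w > 0} w *\<^sub>R Ln w) \<in> borel_measurable borel"
    using open_half_plane
    by (intro borel_measurable_continuous_on_indicator continuous_on_Ln)
       (auto simp: complex_nonpos_Reals_iff)
  hence "(\<lambda>\<xi>. indicator {w. Re w > 0} (?g \<xi>) *\<^sub>R Ln (?g \<xi>)) \<in> borel_measurable borel"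
    by (rule measurable_compose[rotated]) measurable
  also have "(\<lambda>\<xi>. indicator {w. Re w > 0} (?g \<xi>) *\<^sub>R Ln (?g \<xi>)) = log_symbol b \<alpha> \<theta>"
    using assms Re_psi_nonneg[of \<alpha> \<theta>] by (auto simp: log_symbol_def indicator_def add_pos_nonneg)
  finally show ?thesis .
qed

text \<open>The argument of \<open>Ln\<close> has positive real part and so avoids the branch cut.
  The case \<open>\<xi> = 0\<close> is separate because continuity of \<open>powr\<close> in the
  exponent is obtained for a nonzero base.\<close>

lemma continuous_on_log_symbol:
  assumes "continuous_on A \<alpha>" "continuous_on A \<theta>" "b > 0"
    and "\<And>z. z \<in> A \<Longrightarrow> 0 < \<alpha> z \<and> \<alpha> z \<le> 2 \<and> \<bar>\<theta> z\<bar> \<le> min (\<alpha> z) (2 - \<alpha> z)"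
  shows "continuous_on A (\<lambda>z. log_symbol b (\<alpha> z) (\<theta> z) \<xi>)"
proof (cases "\<xi> = 0")
  case False
  have "1 + complex_of_real b * psi (\<alpha> z) (\<theta> z) \<xi> \<notin> \<real>\<^sub>\<le>\<^sub>0" if "z \<in> A" for z
  proof -
    have "Re (1 + complex_of_real b * psi (\<alpha> z) (\<theta> z) \<xi>) > 0"
      using assms(3) assms(4)[OF that] Re_psi_nonneg[of "\<alpha> z" "\<theta> z" \<xi>] by (simp add: add_pos_nonneg)
    thus ?thesis by (auto simp: complex_nonpos_Reals_iff)
  qed
  thus ?thesis
    unfolding log_symbol_def psi_def using False
    by (intro continuous_on_Ln continuous_intros assms) (auto simp: psi_def)
qed simp

subsection \<open>The increments of the process\<close>

text \<open>The joint characteristic function is taken at the two times \<open>r\<close> and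
  \<open>s\<close> with coefficients \<xi> and -\<xi>.\<close>

lemma integral_iexp_increment:
  assumes cont: "\<And>\<xi>. continuous_on {0..} (\<lambda>z. log_symbol b (\<alpha> z) (\<theta> z) \<xi>)"
    and G: "geometric_stable_process_I M b \<alpha> \<theta> G" and sr: "0 \<le> s" "s \<le> r"
  shows "(CLINT \<omega>|M. iexp (\<xi> * (G r \<omega> - G s \<omega>))) =
         exp (- integral {s..r} (\<lambda>z. log_symbol b (\<alpha> z) (\<theta> z) \<xi>))"
proof -
  let ?L = "\<lambda>z. log_symbol b (\<alpha> z) (\<theta> z) \<xi>"
  define x where "x = (\<lambda>j::nat. if j = 0 then \<xi> else - \<xi>)"
  define t where "t = (\<lambda>j::nat. if j = 0 then r else s)"
  have sum2: "(\<Sum>j<2. h j) = h 0 + h 1" for h :: "nat \<Rightarrow> real" by (simp add: numeral_2_eq_2)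
  have "(CLINT \<omega>|M. iexp (\<Sum>j<2. x j * G (t j) \<omega>)) =
      exp (- (CLBINT z:{0..}. log_symbol b (\<alpha> z) (\<theta> z) (\<Sum>j<2. x j * indicator {0..t j} z)))"
    using G sr unfolding geometric_stable_process_I_def log_symbol_def by (simp add: t_def)
  \<comment> \<open>Up to time \<open>s\<close> the two terms cancel and after \<open>r\<close> both
    vanish, so \<open>log_symbol_0\<close> leaves only the interval open at \<open>s\<close> and
    closed at \<open>r\<close>.\<close>
  also have "(CLBINT z:{0..}. log_symbol b (\<alpha> z) (\<theta> z) (\<Sum>j<2. x j * indicator {0..t j} z)) =
      (CLBINT z:{s<..r}. ?L z)"
    unfolding set_lebesgue_integral_def sum2 x_def t_def
    by (intro Bochner_Integration.integral_cong) (use sr in \<open>auto simp: indicator_def\<close>)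
  \<comment> \<open>The gauge integral is the form used by the fundamental theorem of calculus
    later; adding the single point \<open>s\<close> then closes the interval.\<close>
  also have "\<dots> = integral {s<..r} ?L"
  proof (rule set_borel_integral_eq_integral(2))
    have "set_integrable lborel {s..r} ?L"
      using sr by (intro borel_integrable_atLeastAtMost' continuous_on_subset[OF cont]) auto
    thus "set_integrable lborel {s<..r} ?L" by (rule set_integrable_subset) auto
  qed
  also have "\<dots> = integral {s..r} ?L"
    by (rule integral_spike_set; rule negligible_subset[OF negligible_sing[of s]]) auto
  finally show ?thesis by (simp add: sum2 x_def t_def right_diff_distrib)
qed

section \<open>Differentiating the transition operator in time\<close>

theorem theorem10:
  fixes M :: "'a measure" and G :: "real \<Rightarrow> 'a \<Rightarrow> real"
    and \<alpha> \<theta> :: "real \<Rightarrow> real" and b s :: real and f :: "real \<Rightarrow> complex"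
  assumes "b > 0"
    and "continuous_on {0..} \<alpha>" and "continuous_on {0..} \<theta>"
    and "\<And>t. t \<ge> 0 \<Longrightarrow> 0 < \<alpha> t \<and> \<alpha> t \<le> 2 \<and> \<alpha> t \<noteq> 1"
    and "\<And>t. t \<ge> 0 \<Longrightarrow> \<bar>\<theta> t\<bar> \<le> min (\<alpha> t) (2 - \<alpha> t)"
    and "geometric_stable_process_I M b \<alpha> \<theta> G"
    and "schwartz f" and "s \<ge> 0"
  shows "let u = (\<lambda>x t. transition_op M G s t f x) in
    (\<forall>x. \<forall>t\<ge>s. ((\<lambda>r. u x r) has_vector_derivative
        geometric_op b (\<alpha> t) (\<theta> t) (\<lambda>y. u y t) x) (at t within {s..})) \<and>
    (\<forall>x. u x s = f x)"
proof -
  note f = \<open>schwartz f\<close> and G = \<open>geometric_stable_process_I M b \<alpha> \<theta> G\<close>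
  have add: "additive_process M G" using G by (simp add: geometric_stable_process_I_def)
  interpret prob_space M using add by (simp add: additive_process_def)
  have G_meas: "G r \<in> borel_measurable M" if "r \<ge> 0" for r
    using add that by (simp add: additive_process_def)
  note [measurable] = borel_measurable_fourier[OF borel_measurable_schwartz[OF f]]
  define L where "L z \<xi> = log_symbol b (\<alpha> z) (\<theta> z) \<xi>" for z \<xi>
  define \<phi> where "\<phi> r \<xi> = exp (- integral {s..r} (\<lambda>z. L z \<xi>))" for r \<xi>
  have L_cont: "continuous_on {0..} (\<lambda>z. L z \<xi>)" for \<xi>
    unfolding L_def using assms by (intro continuous_on_log_symbol) auto
  have L_bound: "norm (L z \<xi>) \<le> (b + pi) * (1 + \<xi>\<^sup>2)" if "z \<ge> 0" for z \<xi>
    unfolding L_def using assms that by (intro norm_log_symbol_le) auto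
  have L_meas: "L z \<in> borel_measurable borel" if "z \<ge> 0" for z
    unfolding L_def[abs_def] using assms that by (intro borel_measurable_log_symbol) auto
  have \<phi>: "(CLINT \<omega>|M. iexp (\<xi> * (G r \<omega> - G s \<omega>))) = \<phi> r \<xi>" if "r \<ge> s" for r \<xi>
    unfolding \<phi>_def L_def using L_cont G that \<open>s \<ge> 0\<close>
    by (intro integral_iexp_increment) (auto simp: L_def)
  \<comment> \<open>Both this bound and measurability in \<xi> are read off the expectation that
    \<open>\<phi> r\<close> represents, not off the exponent.\<close>
  have \<phi>_le: "norm (\<phi> r \<xi>) \<le> 1" if "r \<ge> s" for r \<xi>
    unfolding \<phi>[OF that, symmetric] by (rule norm_expectation_iexp_le)
  have \<phi>_meas: "\<phi> r \<in> borel_measurable borel" if "r \<ge> s" for r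
  proof -
    have [measurable]: "G r \<in> borel_measurable M" "G s \<in> borel_measurable M"
      using that \<open>s \<ge> 0\<close> by (auto intro: G_meas)
    have "(\<lambda>\<xi>. CLINT \<omega>|M. iexp (\<xi> * (G r \<omega> - G s \<omega>))) \<in> borel_measurable borel" by measurable
    thus ?thesis unfolding \<phi>[OF that] .
  qed
  \<comment> \<open>\<open>u_eq\<close> isolates the dependence on \<open>r\<close> for
    differentiation; \<open>fourier_u\<close> evaluates the transform that occurs in
    \<open>geometric_op\<close> applied to \<open>u\<close>.\<close>
  have u_eq: "transition_op M G s r f x = inverse_fourier (\<lambda>\<xi>. \<phi> r \<xi> * fourier f \<xi>) x"
    and fourier_u: "fourier (\<lambda>x. transition_op M G s r f x) \<xi> = \<phi> r \<xi> * fourier f \<xi>"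
    if "r \<ge> s" for r x \<xi>
  proof -
    have Y: "(\<lambda>\<omega>. G r \<omega> - G s \<omega>) \<in> borel_measurable M" 
      using that \<open>s \<ge> 0\<close> by (intro borel_measurable_diff G_meas) auto
    show "transition_op M G s r f x = inverse_fourier (\<lambda>\<xi>. \<phi> r \<xi> * fourier f \<xi>) x"
      using expectation_shift_eq_inverse_fourier[OF Y f, of x] \<phi>[OF that]
      by (simp add: transition_op_def add_diff_eq)
    show "fourier (\<lambda>x. transition_op M G s r f x) \<xi> = \<phi> r \<xi> * fourier f \<xi>"
      using fourier_expectation_shift[OF Y f, of \<xi>] \<phi>[OF that]
      by (simp add: transition_op_def add_diff_eq)
  qed
  have "((\<lambda>r. transition_op M G s r f x) has_vector_derivative
      geometric_op b (\<alpha> t) (\<theta> t) (\<lambda>y. transition_op M G s t f y) x) (at t within {s..})"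
    if t: "t \<ge> s" for t x
  proof -
    \<comment> \<open>A compact interval, as the fundamental theorem of calculus is applied there.
      The right end \<open>t + 1\<close> keeps \<open>t\<close> away from it, so the filter at
      \<open>t\<close> agrees with that of the half-line; at \<open>t = s\<close> the derivative is
      the right one.\<close>
    let ?S = "{s..t + 1}"
    let ?c = "complex_of_real (1 / sqrt (2 * pi))"
    let ?\<Phi> = "\<lambda>r \<xi>. iexp (\<xi> * x) * (\<phi> r \<xi> * fourier f \<xi>)"
    let ?D = "\<lambda>r \<xi>. iexp (\<xi> * x) * (- L r \<xi> * (\<phi> r \<xi> * fourier f \<xi>))"
    have "((\<lambda>r. CLBINT \<xi>. ?\<Phi> r \<xi>) has_vector_derivative (CLBINT \<xi>. ?D t \<xi>)) (at t within ?S)"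
    proof (rule has_vector_derivative_integral)
      show "convex ?S" "t \<in> ?S" using t by auto
      show "integrable lborel (\<lambda>\<xi>. (b + pi) * ((1 + \<xi>\<^sup>2) * norm (fourier f \<xi>)))"
        using integrable_fourier_schwartz(1)[OF f] by simp
      show "(\<lambda>\<xi>. ?D t \<xi>) \<in> borel_measurable lborel"
      proof -
        have [measurable]: "\<phi> t \<in> borel_measurable borel" "L t \<in> borel_measurable borel"
          using t \<open>s \<ge> 0\<close> by (auto intro: \<phi>_meas L_meas)
        show ?thesis by measurable
      qed
    next
      fix r assume r: "r \<in> ?S"
      have [measurable]: "\<phi> r \<in> borel_measurable borel" using r by (auto intro: \<phi>_meas)
      show "integrable lborel (\<lambda>\<xi>. ?\<Phi> r \<xi>)"
        by (rule Bochner_Integration.integrable_bound[OF integrable_fourier_schwartz(2)[OF f]])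
           (use r in \<open>auto simp: norm_mult intro!: mult_left_le_one_le \<phi>_le\<close>)
      fix \<xi>
      have "((\<lambda>r. integral {s..r} (\<lambda>z. L z \<xi>)) has_vector_derivative L r \<xi>) (at r within ?S)"
        using r \<open>s \<ge> 0\<close>
        by (intro integral_has_vector_derivative continuous_on_subset[OF L_cont]) auto
      \<comment> \<open>The chain rule for \<open>exp\<close> brings down the factor
        \<open>- L r \<xi>\<close>.\<close>
      from has_vector_derivative_minus[OF this]
      have "((\<lambda>r. \<phi> r \<xi>) has_vector_derivative (- L r \<xi> * \<phi> r \<xi>)) (at r within ?S)"
        unfolding \<phi>_def by (intro field_vector_diff_chain_within[unfolded o_def] DERIV_subset[OF DERIV_exp]) auto
      from has_vector_derivative_mult_right[OF this, of "iexp (\<xi> * x) * fourier f \<xi>"]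
      show "((\<lambda>r. ?\<Phi> r \<xi>) has_vector_derivative ?D r \<xi>) (at r within ?S)"
        by (simp add: mult_ac)
      have "norm (?D r \<xi>) = norm (L r \<xi>) * (norm (\<phi> r \<xi>) * norm (fourier f \<xi>))"
        by (simp add: norm_mult)
      also have "\<dots> \<le> ((b + pi) * (1 + \<xi>\<^sup>2)) * (1 * norm (fourier f \<xi>))"
        using r \<open>s \<ge> 0\<close> \<open>b > 0\<close> by (intro mult_mono L_bound \<phi>_le) auto
      finally show "norm (?D r \<xi>) \<le> (b + pi) * ((1 + \<xi>\<^sup>2) * norm (fourier f \<xi>))"
        by (simp add: mult_ac)
    qed
    hence "((\<lambda>r. ?c * (CLBINT \<xi>. ?\<Phi> r \<xi>)) has_vector_derivative ?c * (CLBINT \<xi>. ?D t \<xi>))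
        (at t within ?S)"
      by (rule has_vector_derivative_mult_right)
    moreover have "at t within ?S = at t within {s..}"
      by (rule at_within_nhd[of _ "{..<t + 1}"]) auto
    \<comment> \<open>By \<open>fourier_u\<close> the operator multiplies
      \<open>\<phi> t \<xi> * fourier f \<xi>\<close> by its symbol, which is
      \<open>- L t \<xi>\<close> because the two minus signs in front of \<open>psi\<close>
      cancel.\<close>
    moreover have "geometric_op b (\<alpha> t) (\<theta> t) (\<lambda>y. transition_op M G s t f y) x =
        ?c * (CLBINT \<xi>. ?D t \<xi>)"
      unfolding geometric_op_def fourier_multiplier_def inverse_fourier_def fourier_u[OF t]
      by (simp add: riesz_feller_adj_symbol_def L_def log_symbol_def)
    ultimately have "((\<lambda>r. ?c * (CLBINT \<xi>. ?\<Phi> r \<xi>)) has_vector_derivative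
        geometric_op b (\<alpha> t) (\<theta> t) (\<lambda>y. transition_op M G s t f y) x) (at t within {s..})"
      by simp
    thus ?thesis
      by (rule has_vector_derivative_transform[rotated 2]) (use t u_eq in \<open>auto simp: inverse_fourier_def\<close>)
  qed
  moreover have "transition_op M G s s f x = f x" for x
    by (simp add: transition_op_def prob_space)
  ultimately show ?thesis by (simp add: Let_def)
qed

end
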